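(* Let $k$ and $\ell$ be any positive integers. Then $A_k^{\ell-2}$ is a sparse $(0,1)$-matrix with $k$ ones in each row and $\ell$ ones in each column, and it is of order $C^{k+\ell-1}_{\ell-1}\times C^{k+\ell-1}_{\ell}$.
   Context: $C^a_b$ denotes the binomial coefficient "$a$ choose $b$". A $(0,1)$-matrix is a matrix all of whose entries are $0$ or $1$; a sparse matrix is a $(0,1)$-matrix in which most of the elements are zero; order $p\times q$ means $p$ rows and $q$ columns. $I_p$ is the $p\times p$ identity matrix. If $X$ has $m$ columns and $Y$ is $m\times m$, then $X(Y)$ denotes the matrix obtained by pasting $Y$ below $X$. If $X$ is $n_1\times m_1$ and $Y$ is $n_2\times m_2$ with $n_1\ge n_2$, then $X\sqcup Y$ is the $n_1\times(m_1+m_2)$ matrix obtained by placing $Y$ to the right of $X$ with the bottom rows aligned and filling the remaining upper right $(n_1-n_2)\times m_2$ block with zeros; longer expressions are formed by applying this from left to right. For $k\ge 1$, $\underline{k}$ is the $1\times k$ matrix filled with ones. The matrices $A_k^{j}$ ($k\ge1$, $j\ge -1$) are defined by $A_k^{-1}=\underline{k}$ and, for $j\ge 0$, $A_k^{j}=A_k^{j-1}(I_{C^{k+j}_{j+1}})\sqcup A_{k-1}^{j-1}(I_{C^{k-1+j}_{j+1}})\sqcup\cdots\sqcup A_1^{j-1}(I_{C^{1+j}_{j+1}})$, where each identity matrix has as many rows as the matrix above it has columns.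
   Formalization: "Sparse" is read as more zeros than nonzero entries and is claimed only for k, ℓ ≥ 2 with k+ℓ ≥ 6, exactly where it holds (for k = 1 or ℓ = 1 all entries are ones); everything else is for all positive k, ℓ. *)

theory Defs
  imports "Jordan_Normal_Form.Matrix"
begin

(* The juxtaposition of X and Y with aligned bottom rows and zeros in the upper right corner;
   only meaningful if dim_row Y \<le> dim_row X. *)
definition sqcup_mat :: "'a :: zero mat \<Rightarrow> 'a mat \<Rightarrow> 'a mat" (infixl "\<squnion>\<^sub>m" 65) where
  "X \<squnion>\<^sub>m Y = mat (dim_row X) (dim_col X + dim_col Y)
     (\<lambda>(i, j). if j < dim_col X then X $$ (i, j)
               else if i < dim_row X - dim_row Y then 0
               else Y $$ (i - (dim_row X - dim_row Y), j - dim_col X))"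

definition ones_row :: "nat \<Rightarrow> int mat" where
  "ones_row k = mat 1 k (\<lambda>_. 1)"

(* The superscript, which starts at -1, is shifted by one: sp_mat m k is A_k^(m-1).
   In the second equation the blocks are taken for i = k, k-1, ..., 1 and joined from left to
   right. Only k \<ge> 1 is meaningful. *)
primrec sp_mat :: "nat \<Rightarrow> nat \<Rightarrow> int mat" where
  "sp_mat 0 k = ones_row k"
| "sp_mat (Suc j) k =
     foldl (\<squnion>\<^sub>m)
       (sp_mat j k @\<^sub>r 1\<^sub>m ((k + j) choose (j + 1)))
       (map (\<lambda>i. sp_mat j i @\<^sub>r 1\<^sub>m ((i + j) choose (j + 1))) (rev [1..<k]))"

definition zero_one_mat :: "int mat \<Rightarrow> bool" where
  "zero_one_mat M \<longleftrightarrow> elements_mat M \<subseteq> {0, 1}"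

(* "Most of the elements are zero" is read as: more zero entries than nonzero ones.
   The smallest matrices are not sparse in this sense: the proportion of ones in A_k^(l-2) is
   k! l! / (k + l - 1)!, which is below 1/2 only for k \<ge> 2, l \<ge> 2 and k + l \<ge> 6. *)
definition sparse_mat :: "int mat \<Rightarrow> bool" where
  "sparse_mat M \<longleftrightarrow> zero_one_mat M \<and>
     card {(i, j). i < dim_row M \<and> j < dim_col M \<and> M $$ (i, j) \<noteq> 0}
       < card {(i, j). i < dim_row M \<and> j < dim_col M \<and> M $$ (i, j) = 0}"

end

theory Submission
  imports Defs
begin

text \<open>
  Splitting off the first block of the definition shows that \<open>sp_mat (m + 1) (k + 1)\<close> has upper
  rows \<open>(X, 0)\<close> and lower rows \<open>(I, Y)\<close>, where \<open>X = sp_mat m (k + 1)\<close> and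
  \<open>Y = sp_mat (m + 1) k\<close>, because the identity below \<open>X\<close> has exactly as many rows as \<open>Y\<close>.
  The dimensions (by Pascal's rule), the row sums and the column sums all follow from this
  recursion.
\<close>

section \<open>Bottom-aligned juxtaposition\<close>

lemma dim_sqcup_mat [simp]:
  "dim_row (X \<squnion>\<^sub>m Y) = dim_row X"
  "dim_col (X \<squnion>\<^sub>m Y) = dim_col X + dim_col Y"
  by (simp_all add: sqcup_mat_def)

lemma index_sqcup_mat [simp]:
  assumes "i < dim_row X" and "j < dim_col X + dim_col Y"
  shows "(X \<squnion>\<^sub>m Y) $$ (i, j) =
    (if j < dim_col X then X $$ (i, j)
     else if i < dim_row X - dim_row Y then 0
     else Y $$ (i - (dim_row X - dim_row Y), j - dim_col X))"
  using assms by (simp add: sqcup_mat_def)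

text \<open>With heights that do not increase from left to right, the vertical offsets are honest
  differences and add up, so either bracketing puts every entry of \<open>Z\<close> in the same
  row.\<close>

lemma sqcup_mat_assoc:
  assumes "dim_row Z \<le> dim_row Y" and "dim_row Y \<le> dim_row X"
  shows "(X \<squnion>\<^sub>m Y) \<squnion>\<^sub>m Z = X \<squnion>\<^sub>m (Y \<squnion>\<^sub>m Z)"
proof -
  \<comment> \<open>Naming the height differences replaces truncated subtraction by
    addition.\<close>
  obtain a b where ab: "dim_row Y = dim_row Z + b" "dim_row X = dim_row Z + b + a"
    using assms by (metis le_iff_add)
  show ?thesis
  proof (rule eq_matI)
    fix i j
    assume ij: "i < dim_row (X \<squnion>\<^sub>m (Y \<squnion>\<^sub>m Z))" "j < dim_col (X \<squnion>\<^sub>m (Y \<squnion>\<^sub>m Z))"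
    consider "j < dim_col X" | j' where "j = dim_col X + j'" "j' < dim_col Y"
      | j' where "j = dim_col X + dim_col Y + j'" "j' < dim_col Z"
      using ij by (metis add_less_cancel_left add.assoc dim_sqcup_mat(2) le_iff_add not_less)
    then show "(X \<squnion>\<^sub>m Y \<squnion>\<^sub>m Z) $$ (i, j) = (X \<squnion>\<^sub>m (Y \<squnion>\<^sub>m Z)) $$ (i, j)"
    proof cases
      case 1
      then show ?thesis
        using ij by simp
    next
      case 2
      then show ?thesis
        using ij by (simp add: ab less_diff_conv2)
    next
      case 3
      show ?thesis
      proof (cases "i < a")
        case True
        then show ?thesis
          using ij 3 by (simp add: ab)
      next
        case False
        then obtain i' where "i = a + i'"
          by (metis le_iff_add not_less)
        then show ?thesis
          using ij 3 by (simp add: ab)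
      qed
    qed
  qed (simp_all add: add.assoc)
qed

text \<open>The definition joins blocks from the left, whereas the recursion has to peel off the
  leftmost one. \<open>Y\<close> is generalized because it is the growing accumulator; its height
  stays fixed, so associativity applies at each step.\<close>

lemma foldl_sqcup_mat:
  assumes "\<And>Z. Z \<in> set Zs \<Longrightarrow> dim_row Z \<le> dim_row Y" and "dim_row Y \<le> dim_row X"
  shows "foldl (\<squnion>\<^sub>m) (X \<squnion>\<^sub>m Y) Zs = X \<squnion>\<^sub>m foldl (\<squnion>\<^sub>m) Y Zs"
  using assms by (induction Zs arbitrary: Y) (simp_all add: sqcup_mat_assoc)

lemma dim_row_foldl_sqcup_mat: "dim_row (foldl (\<squnion>\<^sub>m) X Zs) = dim_row X"
  by (induction Zs arbitrary: X) simp_all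

section \<open>Block recursion and dimensions\<close>

lemma append_one_sqcup_mat:
  assumes "X \<in> carrier_mat m n" and "Y \<in> carrier_mat n p"
  shows "(X @\<^sub>r 1\<^sub>m n) \<squnion>\<^sub>m Y = four_block_mat X (0\<^sub>m m p) (1\<^sub>m n) Y"
  using assms by (intro eq_matI) (auto simp: sqcup_mat_def append_rows_def)

text \<open>The dimensions at level \<open>m\<close> are assumed because this recursion is itself
  used in the induction that establishes them.\<close>

lemma sp_mat_Suc_Suc_if_carrier:
  assumes car: "\<And>i. sp_mat m i \<in> carrier_mat ((i + m) choose m) ((i + m) choose (m + 1))"
  shows "sp_mat (Suc m) (Suc k) =
      four_block_mat (sp_mat m (Suc k))
        (0\<^sub>m ((Suc k + m) choose m) (dim_col (sp_mat (Suc m) k)))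
        (1\<^sub>m ((Suc k + m) choose (m + 1))) (sp_mat (Suc m) k)" (is ?block_rec)
    and "dim_row (sp_mat (Suc m) k) = (Suc k + m) choose (m + 1)" (is ?row)
proof -
  let ?B = "\<lambda>i. sp_mat m i @\<^sub>r 1\<^sub>m ((i + m) choose (m + 1))"
  \<comment> \<open>Pascal's rule: the upper matrix and the identity contribute the two
    summands.\<close>
  have row_B: "dim_row (?B i) = (Suc i + m) choose (m + 1)" for i
    using car[of i] by (simp add: append_rows_def)
  have mono: "dim_row (?B i) \<le> dim_row (?B i')" if "i \<le> i'" for i i'
    unfolding row_B using that by (intro binomial_right_mono) simp
  have row: "dim_row (sp_mat (Suc m) k) = (Suc k + m) choose (m + 1)"
    using row_B[of k] by (simp add: dim_row_foldl_sqcup_mat)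
  have "sp_mat (Suc m) (Suc k) = ?B (Suc k) \<squnion>\<^sub>m sp_mat (Suc m) k"
  proof (cases k)
    case 0
    \<comment> \<open>The index 0 lies outside the intended range, but a matrix without columns is
      neutral on the right of a juxtaposition, so the recursion can start there.\<close>
    have "dim_col (sp_mat (Suc m) 0) = 0"
      using car[of 0] by (simp add: append_rows_def)
    then show ?thesis
      unfolding 0 by (intro eq_matI) (auto simp: sqcup_mat_def)
  next
    case (Suc n)
    \<comment> \<open>As \<open>k\<close> is positive, the list \<open>rev [1..<Suc k]\<close>
      starts with \<open>k\<close>.\<close>
    then have "sp_mat (Suc m) (Suc k) =
        foldl (\<squnion>\<^sub>m) (?B (Suc k) \<squnion>\<^sub>m ?B k) (map ?B (rev [1..<k]))"
      by simp
    also have "\<dots> = ?B (Suc k) \<squnion>\<^sub>m foldl (\<squnion>\<^sub>m) (?B k) (map ?B (rev [1..<k]))"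
    proof (rule foldl_sqcup_mat)
      fix Z assume "Z \<in> set (map ?B (rev [1..<k]))"
      then obtain i where "Z = ?B i" "i \<le> k"
        by auto
      then show "dim_row Z \<le> dim_row (?B k)"
        using mono by blast
    qed (rule mono, simp)
    finally show ?thesis
      by simp
  qed
  from trans[OF this append_one_sqcup_mat[OF car carrier_matI[OF row refl]]]
  show ?block_rec .
  show ?row by (rule row)
qed

lemma sp_mat_carrier: "sp_mat m k \<in> carrier_mat ((k + m) choose m) ((k + m) choose (m + 1))"
proof (induction m arbitrary: k)
  case 0
  show ?case by (simp add: ones_row_def)
next
  case (Suc m)
  note IH = Suc
  show ?case
  proof (induction k)
    case 0
    then show ?case
      using Suc[of 0] by (auto simp: append_rows_def)
  next
    case (Suc k)
    have "dim_col (sp_mat (Suc m) (Suc k)) = dim_col (sp_mat m (Suc k)) + dim_col (sp_mat (Suc m) k)"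
      by (subst sp_mat_Suc_Suc_if_carrier(1)[OF IH]) (simp del: sp_mat.simps)
    also have "\<dots> = ((Suc k + m) choose (m + 1)) + ((k + Suc m) choose (Suc m + 1))"
      using carrier_matD(2)[OF IH] carrier_matD(2)[OF Suc] by (simp only:)
    finally have "dim_col (sp_mat (Suc m) (Suc k)) = (Suc k + Suc m) choose (Suc m + 1)"
      by (simp del: sp_mat.simps)
    moreover have "dim_row (sp_mat (Suc m) (Suc k)) = (Suc k + Suc m) choose Suc m"
      using sp_mat_Suc_Suc_if_carrier(2)[OF IH, of "Suc k"] by (simp del: sp_mat.simps)
    ultimately show ?case
      by (intro carrier_matI)
  qed
qed

lemma sp_mat_Suc_Suc:
  "sp_mat (Suc m) (Suc k) =
     four_block_mat (sp_mat m (Suc k))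
       (0\<^sub>m ((Suc k + m) choose m) ((k + m + 1) choose (m + 2)))
       (1\<^sub>m ((Suc k + m) choose (m + 1))) (sp_mat (Suc m) k)"
  using sp_mat_Suc_Suc_if_carrier(1)[OF sp_mat_carrier, of m k] sp_mat_carrier[of "Suc m" k]
  by (simp del: sp_mat.simps)

section \<open>Entries, row sums and column sums\<close>

lemma sum_lessThan_add:
  fixes f :: "nat \<Rightarrow> 'a :: comm_monoid_add"
  shows "(\<Sum>i<m + n. f i) = (\<Sum>i<m. f i) + (\<Sum>i<n. f (m + i))"
  by (induction n) (simp_all add: add.assoc)

text \<open>Sums split along the blocks. An upper row keeps its sum from \<open>X\<close>, and a
  lower row gains 1 from the identity over its sum in \<open>Y\<close>; a left column gains 1 over
  its sum in \<open>X\<close>, and a right column keeps its sum from \<open>Y\<close>.\<close>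

lemma sp_mat_entries_and_sums:
  "(\<forall>i < (k + m) choose m. \<forall>j < (k + m) choose (m + 1). sp_mat m k $$ (i, j) \<in> {0, 1}) \<and>
   (\<forall>i < (k + m) choose m. (\<Sum>j < (k + m) choose (m + 1). sp_mat m k $$ (i, j)) = int k) \<and>
   (\<forall>j < (k + m) choose (m + 1). (\<Sum>i < (k + m) choose m. sp_mat m k $$ (i, j)) = int (m + 1))"
proof (induction m arbitrary: k)
  case 0
  show ?case by (simp add: ones_row_def)
next
  case (Suc m)
  note IHm = Suc
  show ?case
  proof (induction k)
    case 0
    show ?case by (simp add: binomial_eq_0 del: sp_mat.simps binomial_Suc_Suc)
  next
    case (Suc k)
    let ?a = "(Suc k + m) choose m" and ?n = "(Suc k + m) choose (m + 1)"
      and ?q = "(k + m + 1) choose (m + 2)"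
    let ?X = "sp_mat m (Suc k)" and ?Y = "sp_mat (Suc m) k"
    have X: "?X \<in> carrier_mat ?a ?n" and Y: "?Y \<in> carrier_mat ?n ?q"
      using sp_mat_carrier[of m "Suc k"] sp_mat_carrier[of "Suc m" k] by simp_all
    have rows: "(Suc k + Suc m) choose Suc m = ?a + ?n"
      and cols: "(Suc k + Suc m) choose (Suc m + 1) = ?n + ?q"
      by simp_all
    have M: "sp_mat (Suc m) (Suc k) = four_block_mat ?X (0\<^sub>m ?a ?q) (1\<^sub>m ?n) ?Y"
      by (rule sp_mat_Suc_Suc)
    have IHX: "\<forall>i<?a. \<forall>j<?n. ?X $$ (i, j) \<in> {0, 1}" "\<forall>i<?a. (\<Sum>j<?n. ?X $$ (i, j)) = int (Suc k)"
      "\<forall>j<?n. (\<Sum>i<?a. ?X $$ (i, j)) = int (m + 1)"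
      using IHm[of "Suc k"] by blast+
    have IHY: "\<forall>i<?n. \<forall>j<?q. ?Y $$ (i, j) \<in> {0, 1}" "\<forall>i<?n. (\<Sum>j<?q. ?Y $$ (i, j)) = int k"
      "\<forall>j<?q. (\<Sum>i<?n. ?Y $$ (i, j)) = int (Suc m + 1)"
      using Suc by (simp_all del: sp_mat.simps)
    \<comment> \<open>Opaque names keep simplification from expanding the binomial
      coefficients.\<close>
    define a n q where "a = ?a" and "n = ?n" and "q = ?q"
    note fold = a_def[symmetric] n_def[symmetric] q_def[symmetric]
    note X = X[unfolded fold] and Y = Y[unfolded fold]
      and IHX = IHX[unfolded fold] and IHY = IHY[unfolded fold]
    have entries: "\<forall>i<a + n. \<forall>j<n + q. four_block_mat ?X (0\<^sub>m a q) (1\<^sub>m n) ?Y $$ (i, j) \<in> {0, 1}"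
      using X Y IHX(1) IHY(1) by (auto simp del: sp_mat.simps)
    have "(\<Sum>j<n + q. four_block_mat ?X (0\<^sub>m a q) (1\<^sub>m n) ?Y $$ (i, j)) = int (Suc k)"
      if "i < a + n" for i
      using that X Y IHX(2) IHY(2) unfolding sum_lessThan_add
      by (cases "i < a") (auto simp: sum.delta simp del: sp_mat.simps)
    moreover have "(\<Sum>i<a + n. four_block_mat ?X (0\<^sub>m a q) (1\<^sub>m n) ?Y $$ (i, j)) = int (Suc m + 1)"
      if "j < n + q" for j
      using that X Y IHX(3) IHY(3) unfolding sum_lessThan_add
      by (cases "j < n") (auto simp: sum.delta simp del: sp_mat.simps)
    ultimately show ?case
      using entries unfolding rows cols M fold by blast
  qed
qed

section \<open>Counting ones, and sparsity\<close>

lemma int_card_eq_sum_zero_one: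
  fixes f :: "nat \<Rightarrow> int"
  assumes "\<And>i. i < n \<Longrightarrow> f i \<in> {0, 1}"
  shows "int (card {i. i < n \<and> f i = 1}) = (\<Sum>i<n. f i)"
proof -
  have "(\<Sum>i<n. f i) = (\<Sum>i<n. if f i = 1 then 1 else 0)"
    using assms by (intro sum.cong) auto
  also have "\<dots> = int (card ({..<n} \<inter> {i. f i = 1}))"
    by (simp add: sum.If_cases)
  also have "{..<n} \<inter> {i. f i = 1} = {i. i < n \<and> f i = 1}"
    by auto
  finally show ?thesis by simp
qed

text \<open>The right side is the length of a row, so fewer than half of its entries are ones. The
  cases \<open>k = 2\<close> and \<open>l = 2\<close> are the tight ones; otherwise, the symmetric
  form is monotone in \<open>l\<close>, which reduces the claim to \<open>l = 3\<close>.\<close>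

lemma double_less_choose:
  fixes k l :: nat
  assumes "k \<ge> 2" "l \<ge> 2" "k + l \<ge> 6"
  shows "2 * k < (k + l - 1) choose l"
proof -
  have sym: "(k + l - 1) choose l = (k + l - 1) choose (k - 1)"
    using assms binomial_symmetric[of l "k + l - 1"] by simp
  consider "k = 2" "l \<ge> 4" | "l = 2" "k \<ge> 4" | "k \<ge> 3" "l \<ge> 3"
    using assms by linarith
  then show ?thesis
  proof cases
    case 1
    then show ?thesis unfolding sym by simp
  next
    case 2
    \<comment> \<open>Here \<open>k + 1 \<ge> 5\<close>, and the surplus \<open>k\<close> over
      \<open>4 * k\<close> is at least 2; halving then leaves a strict inequality.\<close>
    then have "2 * (2 * k) + 2 \<le> k * (k + 1)"
      using mult_le_mono2[of 5 "k + 1" k] by linarith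
    then show ?thesis
      using 2 by (simp add: choose_two mult.commute)
  next
    case 3
    then obtain n where k: "k = n + 3"
      using le_iff_add by (metis add.commute)
    have "2 * k < (k + 2) choose 3"
      unfolding k by (induction n) (simp_all add: eval_nat_numeral)
    also have "\<dots> = (k + 2) choose (k - 1)"
      using 3 binomial_symmetric[of 3 "k + 2"] by simp
    also have "\<dots> \<le> (k + l - 1) choose (k - 1)"
      using 3 by (intro binomial_right_mono) simp
    finally show ?thesis unfolding sym .
  qed
qed

text \<open>Counting row by row gives \<open>r * k\<close> nonzero entries out of
  \<open>r * c\<close>, which is less than half since \<open>r\<close> is positive.\<close>

lemma sparse_mat_of_row_count:
  assumes "zero_one_mat M" and "M \<in> carrier_mat r c" and "r > 0" and "2 * k < c"
    and rows: "\<And>i. i < r \<Longrightarrow> card {j. j < c \<and> M $$ (i, j) = 1} = k"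
  shows "sparse_mat M"
proof -
  let ?N = "{(i, j). i < r \<and> j < c \<and> M $$ (i, j) \<noteq> 0}"
  let ?Z = "{(i, j). i < r \<and> j < c \<and> M $$ (i, j) = 0}"
  have "M $$ (i, j) \<in> {0, 1}" if "i < r" "j < c" for i j
    using assms(1,2) that unfolding zero_one_mat_def by blast
  then have "?N = (SIGMA i:{..<r}. {j. j < c \<and> M $$ (i, j) = 1})"
    by force
  then have N: "card ?N = r * k"
    using rows by simp
  have un: "?N \<union> ?Z = {..<r} \<times> {..<c}"
    by auto
  have "finite (?N \<union> ?Z)"
    unfolding un by simp
  then have "finite ?N" "finite ?Z"
    by (rule finite_subset[rotated], blast)+
  then have "card ?N + card ?Z = card (?N \<union> ?Z)"
    by (intro card_Un_disjoint[symmetric]) auto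
  then have total: "card ?N + card ?Z = r * c"
    using un by simp
  have "r * (2 * k) < r * c"
    using assms by simp
  then have "card ?N < card ?Z"
    using N total by linarith
  then show ?thesis
    using assms(1,2) by (auto simp: sparse_mat_def)
qed

theorem theorem3p2:
  fixes k l :: nat
  assumes "k \<ge> 1" and "l \<ge> 1"
  defines "A \<equiv> sp_mat (l - 1) k"
  shows "zero_one_mat A
    \<and> (k \<ge> 2 \<and> l \<ge> 2 \<and> k + l \<ge> 6 \<longrightarrow> sparse_mat A)
    \<and> (\<forall>i < dim_row A. card {j. j < dim_col A \<and> A $$ (i, j) = 1} = k)
    \<and> (\<forall>j < dim_col A. card {i. i < dim_row A \<and> A $$ (i, j) = 1} = l)
    \<and> A \<in> carrier_mat ((k + l - 1) choose (l - 1)) ((k + l - 1) choose l)"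
proof -
  define r c where "r = (k + l - 1) choose (l - 1)" and "c = (k + l - 1) choose l"
  have A: "A \<in> carrier_mat r c"
    using sp_mat_carrier[of "l - 1" k] \<open>l \<ge> 1\<close> by (simp add: A_def r_def c_def)
  have entries: "\<forall>i<r. \<forall>j<c. A $$ (i, j) \<in> {0, 1}"
    and row_sum: "\<forall>i<r. (\<Sum>j<c. A $$ (i, j)) = int k"
    and col_sum: "\<forall>j<c. (\<Sum>i<r. A $$ (i, j)) = int l"
    using sp_mat_entries_and_sums[of k "l - 1"] \<open>l \<ge> 1\<close> by (simp_all add: A_def r_def c_def)
  have zo: "zero_one_mat A"
    using A entries unfolding zero_one_mat_def by fastforce
  have rows: "card {j. j < c \<and> A $$ (i, j) = 1} = k" if "i < r" for i
    using int_card_eq_sum_zero_one[of c "\<lambda>j. A $$ (i, j)"] entries row_sum that by simp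
  have cols: "card {i. i < r \<and> A $$ (i, j) = 1} = l" if "j < c" for j
    using int_card_eq_sum_zero_one[of r "\<lambda>i. A $$ (i, j)"] entries col_sum that by simp
  have "r > 0"
    using \<open>k \<ge> 1\<close> by (simp add: r_def)
  then have "sparse_mat A" if "k \<ge> 2" "l \<ge> 2" "k + l \<ge> 6"
    using sparse_mat_of_row_count[OF zo A] rows double_less_choose[OF that] by (simp add: c_def)
  then show ?thesis
    using zo rows cols A by (auto simp: r_def c_def)
qed

end
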